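(* For every $m\ge 2$, $MC(I_2(m))=2$, where $I_2(m)$ is the dihedral group of order $2m$ with its two standard Coxeter generators $s_1,s_2$ subject to $s_1^2=s_2^2=(s_1s_2)^m=1$.
   Context: Let $(W,S)$ be a finite Coxeter system with length function $\ell$, and let $R=\bigcup_{w\in W,\,s\in S}\{wsw^{-1}\}$ be its set of reflections. For $w\in W$ set $N(w)=\{t\in R\mid \ell(wt)<\ell(w)\}$. A subset $Y\subset W$ is inversion complete if $\bigcup_{w\in Y}N(w)=R$; it is minimal inversion complete if it is inversion complete and no proper subset of $Y$ is inversion complete. If $(W,S)$ is of type $T$, $MC(T)$ denotes the maximal cardinality of a minimal inversion complete subset of $W$. *)

theory Defs
  imports "HOL-Algebra.Multiplicative_Group" "HOL-Algebra.Generated_Groups"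
begin

definition word_prod :: "('a, 'b) monoid_scheme \<Rightarrow> 'a list \<Rightarrow> 'a" where
  "word_prod W ws = foldr (mult W) ws (one W)"

text \<open>
  Consequences of the Coxeter relations \<open>(s t)\<^sup>m = 1\<close>, \<open>m\<close> the order of \<open>s t\<close>, on words over \<open>S\<close>.
  In the library an element of infinite order has \<open>ord = 0\<close>, so that such a pair contributes only
  the trivial relation.  For \<open>s = t\<close> an involution one gets the relation \<open>s s = 1\<close>, and therefore
  no formal inverses are needed in the words.
\<close>

inductive coxeter_equiv :: "('a, 'b) monoid_scheme \<Rightarrow> 'a set \<Rightarrow> 'a list \<Rightarrow> 'a list \<Rightarrow> bool"
  for W :: "('a, 'b) monoid_scheme" and S :: "'a set" where
  relation: "\<lbrakk>s \<in> S; t \<in> S; us \<in> lists S; vs \<in> lists S\<rbrakk> \<Longrightarrow>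
    coxeter_equiv W S (us @ concat (replicate (group.ord W (s \<otimes>\<^bsub>W\<^esub> t)) [s, t]) @ vs) (us @ vs)"
| refl: "ws \<in> lists S \<Longrightarrow> coxeter_equiv W S ws ws"
| sym: "coxeter_equiv W S us vs \<Longrightarrow> coxeter_equiv W S vs us"
| trans: "\<lbrakk>coxeter_equiv W S us vs; coxeter_equiv W S vs ws\<rbrakk> \<Longrightarrow> coxeter_equiv W S us ws"

text \<open>
  The last axiom says that \<open>W\<close> is presented by the generators \<open>S\<close> and the Coxeter relations
  (the converse implication holds by the definition of the order of an element).
\<close>

locale coxeter_system = group W for W :: "('a, 'b) monoid_scheme" (structure) +
  fixes S :: "'a set"
  assumes S_carrier: "S \<subseteq> carrier W"
    and S_nontrivial: "\<one> \<notin> S"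
    and S_involution: "s \<in> S \<Longrightarrow> s \<otimes> s = \<one>"
    and S_generates: "generate W S = carrier W"
    and presentation: "\<lbrakk>ws \<in> lists S; word_prod W ws = \<one>\<rbrakk> \<Longrightarrow> coxeter_equiv W S ws []"

definition coxeter_system_I2 :: "nat \<Rightarrow> ('a, 'b) monoid_scheme \<Rightarrow> 'a set \<Rightarrow> bool" where
  "coxeter_system_I2 m W S \<longleftrightarrow>
    coxeter_system W S \<and>
    (\<exists>s1 s2. s1 \<noteq> s2 \<and> S = {s1, s2} \<and> group.ord W (s1 \<otimes>\<^bsub>W\<^esub> s2) = m)"

definition cox_length :: "('a, 'b) monoid_scheme \<Rightarrow> 'a set \<Rightarrow> 'a \<Rightarrow> nat" where
  "cox_length W S w = (LEAST n. \<exists>ws \<in> lists S. length ws = n \<and> word_prod W ws = w)"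

definition reflections :: "('a, 'b) monoid_scheme \<Rightarrow> 'a set \<Rightarrow> 'a set" where
  "reflections W S = (\<Union>w \<in> carrier W. \<Union>s \<in> S. {w \<otimes>\<^bsub>W\<^esub> s \<otimes>\<^bsub>W\<^esub> inv\<^bsub>W\<^esub> w})"

definition inversions :: "('a, 'b) monoid_scheme \<Rightarrow> 'a set \<Rightarrow> 'a \<Rightarrow> 'a set" where
  "inversions W S w = {t \<in> reflections W S. cox_length W S (w \<otimes>\<^bsub>W\<^esub> t) < cox_length W S w}"

definition inversion_complete :: "('a, 'b) monoid_scheme \<Rightarrow> 'a set \<Rightarrow> 'a set \<Rightarrow> bool" where
  "inversion_complete W S Y \<longleftrightarrow>
    Y \<subseteq> carrier W \<and> (\<Union>w \<in> Y. inversions W S w) = reflections W S"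

definition minimal_inversion_complete ::
  "('a, 'b) monoid_scheme \<Rightarrow> 'a set \<Rightarrow> 'a set \<Rightarrow> bool" where
  "minimal_inversion_complete W S Y \<longleftrightarrow>
    inversion_complete W S Y \<and> (\<forall>Z. Z \<subset> Y \<longrightarrow> \<not> inversion_complete W S Z)"

text \<open>Meaningful for finite \<open>W\<close> only.\<close>

definition MC :: "('a, 'b) monoid_scheme \<Rightarrow> 'a set \<Rightarrow> nat" where
  "MC W S = Max {card Y | Y. minimal_inversion_complete W S Y}"


text \<open>
  Coxeter systems of type \<open>I\<^sub>2(m)\<close> exist: in the dihedral group of order \<open>2 m\<close> below, \<open>(a, False)\<close> is
  the rotation by \<open>2 \<pi> a / m\<close> and \<open>(a, True)\<close> is that rotation after a fixed reflection.
\<close>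

definition dihedral :: "nat \<Rightarrow> (int \<times> bool) monoid" where
  "dihedral m = \<lparr>carrier = {0..<int m} \<times> UNIV,
    mult = (\<lambda>x y. ((if snd x then fst x - fst y else fst x + fst y) mod int m, snd x \<noteq> snd y)),
    one = (0, False)\<rparr>"

definition dihedral_gens :: "(int \<times> bool) set" where
  "dihedral_gens = {(1, True), (0, True)}"

context
  fixes m :: nat
  assumes m2: "2 \<le> m"
begin

lemma group_dihedral: "group (dihedral m)"
proof (rule groupI)
  fix x y z
  assume "x \<in> carrier (dihedral m)" "y \<in> carrier (dihedral m)" "z \<in> carrier (dihedral m)"
  then show "x \<otimes>\<^bsub>dihedral m\<^esub> y \<otimes>\<^bsub>dihedral m\<^esub> z = x \<otimes>\<^bsub>dihedral m\<^esub> (y \<otimes>\<^bsub>dihedral m\<^esub> z)"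
    by (auto simp: dihedral_def mod_simps algebra_simps)
next
  fix x assume x: "x \<in> carrier (dihedral m)"
  let ?y = "(if snd x then fst x else (- fst x) mod int m, snd x)"
  have "?y \<in> carrier (dihedral m)" "?y \<otimes>\<^bsub>dihedral m\<^esub> x = \<one>\<^bsub>dihedral m\<^esub>"
    using x m2 by (auto simp: dihedral_def mod_simps)
  then show "\<exists>y\<in>carrier (dihedral m). y \<otimes>\<^bsub>dihedral m\<^esub> x = \<one>\<^bsub>dihedral m\<^esub>" by blast
qed (use m2 in \<open>auto simp: dihedral_def\<close>)

interpretation D: group "dihedral m" by (rule group_dihedral)

lemma dihedral_pow: "(1, False) [^]\<^bsub>dihedral m\<^esub> (k::nat) = (int k mod int m, False)"
proof (induction k)
  case 0
  then show ?case by (simp add: dihedral_def)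
next
  case (Suc k)
  then show ?case
    by (simp add: D.nat_pow_Suc) (simp add: dihedral_def mod_simps add.commute)
qed

lemma dihedral_gens_carrier: "dihedral_gens \<subseteq> carrier (dihedral m)"
  using m2 by (auto simp: dihedral_def dihedral_gens_def)

lemma ord_dihedral: "D.ord ((1, True) \<otimes>\<^bsub>dihedral m\<^esub> (0, True)) = m"
proof -
  have e: "(1, True) \<otimes>\<^bsub>dihedral m\<^esub> (0, True) = (1, False)"
    using m2 by (simp add: dihedral_def)
  have c: "(1, False) \<in> carrier (dihedral m)"
    using m2 by (simp add: dihedral_def)
  have "D.ord (1, False) = m"
  proof (subst D.ord_unique[OF c], intro allI)
    fix n :: nat
    have "int n mod int m = 0 \<longleftrightarrow> m dvd n"
      by (metis dvd_eq_mod_eq_0 int_dvd_int_iff)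
    then show "((1, False) [^]\<^bsub>dihedral m\<^esub> n = \<one>\<^bsub>dihedral m\<^esub>) = (m dvd n)"
      by (simp add: dihedral_pow) (simp add: dihedral_def)
  qed
  then show ?thesis by (simp add: e)
qed

lemma dihedral_gens_involution:
  "s \<in> dihedral_gens \<Longrightarrow> s \<otimes>\<^bsub>dihedral m\<^esub> s = \<one>\<^bsub>dihedral m\<^esub>"
  by (auto simp: dihedral_def dihedral_gens_def)

abbreviation "rot k \<equiv> concat (replicate k [(1::int, True), (0, True)])"

lemma rot_gens: "rot k \<in> lists dihedral_gens"
  by (induction k) (auto simp: dihedral_gens_def)

lemma rot_Suc: "rot (Suc k) = rot k @ [(1, True), (0, True)]"
  by (induction k) auto

lemma rot_add: "rot (k + l) = rot k @ rot l"
  by (simp add: replicate_add)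

lemma pair_word_lists: "s \<in> S \<Longrightarrow> t \<in> S \<Longrightarrow> concat (replicate k [s, t]) \<in> lists S"
  by (induction k) auto

lemma equiv_lists:
  "coxeter_equiv W S us vs \<Longrightarrow> us \<in> lists S \<and> vs \<in> lists S"
proof (induction rule: coxeter_equiv.induct)
  case (relation s t us vs)
  then show ?case by (simp add: pair_word_lists)
qed auto

lemma equiv_append:
  assumes "coxeter_equiv W S us vs" "ws \<in> lists S"
  shows "coxeter_equiv W S (us @ ws) (vs @ ws)"
  using assms(1)
proof (induction rule: coxeter_equiv.induct)
  case (relation s t us vs)
  then show ?case
    using coxeter_equiv.relation[of s S t us "vs @ ws"] assms(2) by simp
next
  case (refl us)
  then show ?case using assms(2) by (intro coxeter_equiv.refl) auto
qed (blast intro: coxeter_equiv.sym coxeter_equiv.trans)+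

lemma equiv_cancel:
  assumes "s \<in> dihedral_gens" "us \<in> lists dihedral_gens" "vs \<in> lists dihedral_gens"
  shows "coxeter_equiv (dihedral m) dihedral_gens (us @ [s, s] @ vs) (us @ vs)"
  using coxeter_equiv.relation[of s dihedral_gens s us vs "dihedral m"] assms
  by (simp add: dihedral_gens_involution)

lemma equiv_rot:
  assumes "us \<in> lists dihedral_gens" "vs \<in> lists dihedral_gens"
  shows "coxeter_equiv (dihedral m) dihedral_gens (us @ rot m @ vs) (us @ vs)"
  using coxeter_equiv.relation[of "(1, True)" dihedral_gens "(0, True)" us vs "dihedral m"] assms
  by (simp add: ord_dihedral) (simp add: dihedral_gens_def)

lemma equiv_rot_mult: "coxeter_equiv (dihedral m) dihedral_gens (rot (j * m)) []"
proof (induction j)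
  case 0
  then show ?case by (auto intro: coxeter_equiv.refl)
next
  case (Suc j)
  have "coxeter_equiv (dihedral m) dihedral_gens (rot m @ rot (j * m)) (rot (j * m))"
    using equiv_rot[of "[]" "rot (j * m)"] rot_gens by simp
  then show ?case
    using Suc by (metis coxeter_equiv.trans mult_Suc rot_add)
qed

lemma normal_form:
  assumes "ws \<in> lists dihedral_gens"
  shows "\<exists>k e. coxeter_equiv (dihedral m) dihedral_gens ws
    (rot k @ (if e then [(0, True)] else []))"
  using assms
proof (induction ws rule: rev_induct)
  case Nil
  have "coxeter_equiv (dihedral m) dihedral_gens [] (rot 0 @ (if False then [(0, True)] else []))"
    by (simp add: coxeter_equiv.refl)
  then show ?case by blast
next
  case (snoc s ws)
  let ?E = "coxeter_equiv (dihedral m) dihedral_gens"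
  have s: "s \<in> dihedral_gens" and ws: "ws \<in> lists dihedral_gens" using snoc.prems by auto
  have g: "(0, True) \<in> dihedral_gens" "(1, True) \<in> dihedral_gens" by (auto simp: dihedral_gens_def)
  obtain k e where ke: "?E ws (rot k @ (if e then [(0, True)] else []))"
    using snoc.IH ws by blast
  have st: "?E (ws @ [s]) ((rot k @ (if e then [(0, True)] else [])) @ [s])"
    using equiv_append[OF ke] s by simp
  have "\<exists>l f. ?E ((rot k @ (if e then [(0, True)] else [])) @ [s])
    (rot l @ (if f then [(0, True)] else []))"
  proof (cases e)
    case False
    show ?thesis
    proof (cases "s = (0, True)")
      case True
      have "?E (rot k @ [(0, True)]) (rot k @ [(0, True)])"
        by (rule coxeter_equiv.refl) (use g rot_gens in simp)
      then show ?thesis using True False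
        by (intro exI[of _ k] exI[of _ True]) (simp only: if_True if_False append_Nil2)
    next
      case s1: False
      then have s1: "s = (1, True)" using s by (auto simp: dihedral_gens_def)
      have "?E ((rot k @ [s]) @ [(0, True), (0, True)] @ []) ((rot k @ [s]) @ [])"
        by (rule equiv_cancel) (use g s rot_gens in simp_all)
      then have "?E (rot k @ [s]) (rot (Suc k) @ (if True then [(0, True)] else []))"
        by - (rule coxeter_equiv.sym, simp add: s1 rot_Suc del: replicate.simps)
      then show ?thesis using False
        by (intro exI[of _ "Suc k"] exI[of _ True]) (simp only: if_True if_False append_Nil2)
    qed
  next
    case True
    show ?thesis
    proof (cases "s = (0, True)")
      case s0: True
      have "?E (rot k @ [(0, True), (0, True)] @ []) (rot k @ [])"
        by (rule equiv_cancel) (use g rot_gens in simp_all)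
      then have "?E ((rot k @ (if e then [(0, True)] else [])) @ [s])
          (rot k @ (if False then [(0, True)] else []))"
        using s0 True by simp
      then show ?thesis by blast
    next
      case False
      then have s1: "s = (1, True)" using s by (auto simp: dihedral_gens_def)
      obtain l where l: "k + m = Suc l" using m2 by (cases "k + m") auto
      have "?E (rot k @ rot m @ [(0, True), s]) (rot k @ [(0, True), s])"
        by (rule equiv_rot) (use g s rot_gens in simp_all)
      then have a: "?E (rot k @ [(0, True), s]) (rot (Suc l) @ [(0, True), s])"
        unfolding l[symmetric] rot_add by - (rule coxeter_equiv.sym, simp)
      have "?E ((rot l @ [s]) @ [(0, True), (0, True)] @ [s]) ((rot l @ [s]) @ [s])"
        by (rule equiv_cancel) (use g s rot_gens in simp_all)
      then have b: "?E (rot (Suc l) @ [(0, True), s]) (rot l @ [s, s])"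
        unfolding rot_Suc s1 by simp
      have c: "?E (rot l @ [s, s] @ []) (rot l @ [])"
        by (rule equiv_cancel) (use g s rot_gens in simp_all)
      have "?E ((rot k @ (if e then [(0, True)] else [])) @ [s])
          (rot l @ (if False then [(0, True)] else []))"
        using coxeter_equiv.trans[OF coxeter_equiv.trans[OF a b]] c True by simp
      then show ?thesis by blast
    qed
  qed
  then show ?case using coxeter_equiv.trans[OF st] by blast
qed

lemma word_prod_closed:
  "us \<in> lists dihedral_gens \<Longrightarrow> word_prod (dihedral m) us \<in> carrier (dihedral m)"
  by (induction us) (use dihedral_gens_carrier in \<open>auto simp: word_prod_def\<close>)

lemma word_prod_append:
  "us \<in> lists dihedral_gens \<Longrightarrow> vs \<in> lists dihedral_gens \<Longrightarrow>
    word_prod (dihedral m) (us @ vs) = word_prod (dihedral m) us \<otimes>\<^bsub>dihedral m\<^esub> word_prod (dihedral m) vs"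
proof (induction us)
  case Nil
  then show ?case using word_prod_closed by (simp add: word_prod_def)
next
  case (Cons s us)
  then have "s \<in> carrier (dihedral m)" using dihedral_gens_carrier by auto
  then show ?case using Cons word_prod_closed by (simp add: word_prod_def D.m_assoc)
qed

lemma word_prod_replicate:
  assumes "s \<in> dihedral_gens" "t \<in> dihedral_gens"
  shows "word_prod (dihedral m) (concat (replicate k [s, t])) = (s \<otimes>\<^bsub>dihedral m\<^esub> t) [^]\<^bsub>dihedral m\<^esub> k"
proof (induction k)
  case 0
  then show ?case by (simp add: word_prod_def)
next
  case (Suc k)
  have c: "s \<in> carrier (dihedral m)" "t \<in> carrier (dihedral m)"
    using assms dihedral_gens_carrier by auto
  have "word_prod (dihedral m) ([s, t] @ concat (replicate k [s, t]))
    = word_prod (dihedral m) [s, t] \<otimes>\<^bsub>dihedral m\<^esub> word_prod (dihedral m) (concat (replicate k [s, t]))"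
    by (rule word_prod_append) (use assms in \<open>simp_all add: pair_word_lists\<close>)
  then show ?case
    using Suc c D.nat_pow_Suc2[of "s \<otimes>\<^bsub>dihedral m\<^esub> t" k] by (simp add: word_prod_def)
qed

lemma equiv_sound:
  assumes "coxeter_equiv (dihedral m) dihedral_gens us vs"
  shows "word_prod (dihedral m) us = word_prod (dihedral m) vs"
  using assms
proof (induction rule: coxeter_equiv.induct)
  case (relation s t us vs)
  have c: "s \<otimes>\<^bsub>dihedral m\<^esub> t \<in> carrier (dihedral m)"
    using relation dihedral_gens_carrier by auto
  let ?r = "concat (replicate (D.ord (s \<otimes>\<^bsub>dihedral m\<^esub> t)) [s, t])"
  have r: "?r \<in> lists dihedral_gens"
    using relation by (simp add: pair_word_lists)
  have "word_prod (dihedral m) ?r = \<one>\<^bsub>dihedral m\<^esub>"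
    using relation word_prod_replicate D.pow_ord_eq_1[OF c] by simp
  then show ?case
    using relation r word_prod_closed by (simp add: word_prod_append del: set_concat)
qed auto

theorem coxeter_system_dihedral: "coxeter_system_I2 m (dihedral m) dihedral_gens"
  unfolding coxeter_system_I2_def
proof
  show "\<exists>s1 s2. s1 \<noteq> s2 \<and> dihedral_gens = {s1, s2} \<and> D.ord (s1 \<otimes>\<^bsub>dihedral m\<^esub> s2) = m"
    using ord_dihedral by (intro exI[of _ "(1, True)"] exI[of _ "(0, True)"])
      (simp add: dihedral_gens_def)
  show "coxeter_system (dihedral m) dihedral_gens"
  proof (unfold_locales)
    show "dihedral_gens \<subseteq> carrier (dihedral m)" by (rule dihedral_gens_carrier)
    show "\<one>\<^bsub>dihedral m\<^esub> \<notin> dihedral_gens" by (simp add: dihedral_def dihedral_gens_def)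
    show "s \<otimes>\<^bsub>dihedral m\<^esub> s = \<one>\<^bsub>dihedral m\<^esub>" if "s \<in> dihedral_gens" for s
      using that by (rule dihedral_gens_involution)
    show "generate (dihedral m) dihedral_gens = carrier (dihedral m)" (is "?G = _")
    proof
      show "?G \<subseteq> carrier (dihedral m)"
        using D.generate_incl[OF dihedral_gens_carrier] .
      have s: "(1, True) \<in> ?G" "(0, True) \<in> ?G"
        by (auto simp: dihedral_gens_def intro: generate.incl)
      have "(1, True) \<otimes>\<^bsub>dihedral m\<^esub> (0, True) \<in> ?G" using s by (rule generate.eng)
      then have r: "(1, False) \<in> ?G" using m2 by (simp add: dihedral_def)
      have rp: "(1, False) [^]\<^bsub>dihedral m\<^esub> (k::nat) \<in> ?G" for k
          by (induction k) (simp_all add: generate.one generate.eng r)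
      show "carrier (dihedral m) \<subseteq> ?G"
      proof
        fix x assume x: "x \<in> carrier (dihedral m)"
        then obtain a e where ae: "x = (a, e)" "0 \<le> a" "a < int m" by (auto simp: dihedral_def)
        have a: "(a, False) \<in> ?G" using rp[of "nat a"] ae by (simp add: dihedral_pow)
        have "(a, False) \<otimes>\<^bsub>dihedral m\<^esub> (0, True) \<in> ?G" using a s(2) by (rule generate.eng)
        then have "(a, True) \<in> ?G" using ae by (simp add: dihedral_def)
        then show "x \<in> ?G" using a ae by (cases e) auto
      qed
    qed
    fix ws assume ws: "ws \<in> lists dihedral_gens" and p: "word_prod (dihedral m) ws = \<one>\<^bsub>dihedral m\<^esub>"
    obtain k e where ke: "coxeter_equiv (dihedral m) dihedral_gens ws
        (rot k @ (if e then [(0, True)] else []))"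
      using normal_form[OF ws] by blast
    have g: "(0, True) \<in> dihedral_gens" "(1, True) \<in> dihedral_gens"
      by (auto simp: dihedral_gens_def)
    have "word_prod (dihedral m) (rot k) = (1, False) [^]\<^bsub>dihedral m\<^esub> k"
      using word_prod_replicate[OF g(2,1), of k] m2 by (simp add: dihedral_def)
    then have "word_prod (dihedral m) (rot k) = (int k mod int m, False)"
      by (simp add: dihedral_pow)
    moreover have "word_prod (dihedral m) (if e then [(0, True)] else []) = (0, e)"
      using m2 by (simp add: word_prod_def dihedral_def)
    moreover have "word_prod (dihedral m) (rot k) \<otimes>\<^bsub>dihedral m\<^esub>
        word_prod (dihedral m) (if e then [(0, True)] else []) = \<one>\<^bsub>dihedral m\<^esub>"
      using equiv_sound[OF ke] p rot_gens g
      by (subst word_prod_append[symmetric]) auto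
    ultimately have "int k mod int m = 0" "\<not> e" by (auto simp: dihedral_def)
    then obtain j where "k = j * m"
      by (metis dvd_eq_mod_eq_0 int_dvd_int_iff dvdE mult.commute)
    then show "coxeter_equiv (dihedral m) dihedral_gens ws []"
      using coxeter_equiv.trans[OF _ equiv_rot_mult[of j]] ke \<open>\<not> e\<close>
      by (simp del: replicate.simps)
  qed
qed

end

end

theory Submission
  imports Defs
begin

text \<open>
  The Cayley graph of \<open>I\<^sub>2(m)\<close> is a cycle of length \<open>2 m\<close>, in which the elements lie at the positions
  \<open>- m \<le> k \<le> m\<close> and the reflections at the odd ones.  The inversions of the element at \<open>k\<close> are the
  reflections strictly between \<open>0\<close> and \<open>2 k\<close>.  So the inversion sets form two chains, one for \<open>k \<ge> 0\<close>
  and one for \<open>k \<le> 0\<close>, and an inversion complete set needs at most one element from each.  The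
  positions \<open>m - 1\<close> and \<open>1 - m\<close> attain the bound.
\<close>

section \<open>Parity of words and chains of sets\<close>

text \<open>Every relator is a power of a two-letter word, so it has even length. This invariant
  will separate the even positions of the cycle from the odd ones.\<close>

lemma coxeter_equiv_even_length:
  "coxeter_equiv W S us vs \<Longrightarrow> even (length us) \<longleftrightarrow> even (length vs)"
proof (induction rule: coxeter_equiv.induct)
  case (relation s t us vs)
  have "even (length (concat (replicate n [s, t])))" for n
    by (induction n) auto
  then show ?case by simp
qed auto

text \<open>An index of maximal absolute value covers the whole union. This will be applied to the
  positions on one side of 0, where the inversion sets are nested.\<close>

lemma UN_abs_chain:
  fixes K :: "int set"
  assumes "finite K" and mono: "\<And>k l. \<lbrakk>k \<in> K; l \<in> K; \<bar>k\<bar> \<le> \<bar>l\<bar>\<rbrakk> \<Longrightarrow> F k \<subseteq> F l"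
  shows "\<exists>J \<subseteq> K. finite J \<and> card J \<le> 1 \<and> (\<Union>k\<in>K. F k) \<subseteq> (\<Union>k\<in>J. F k)"
proof (cases "K = {}")
  case False
  then have "Max (abs ` K) \<in> abs ` K" using assms(1) by (intro Max_in) auto
  then obtain l where l: "l \<in> K" "\<bar>l\<bar> = Max (abs ` K)" by auto
  then have "\<bar>k\<bar> \<le> \<bar>l\<bar>" if "k \<in> K" for k
    using that assms(1) by simp
  then have "(\<Union>k\<in>K. F k) \<subseteq> (\<Union>k\<in>{l}. F k)"
    using mono l(1) by (simp add: UN_least)
  then show ?thesis using l(1) by (intro exI[of _ "{l}"]) simp
qed auto

section \<open>The group as a cycle\<close>

locale dihedral_coxeter_system = coxeter_system +
  fixes s t :: 'a and m :: nat
  assumes S_eq: "S = {s, t}" and ord_ts: "ord (t \<otimes> s) = m" and m_ge_2: "m \<ge> 2"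
begin

lemma s_closed [simp]: "s \<in> carrier W" and t_closed [simp]: "t \<in> carrier W"
  using S_carrier S_eq by auto

lemma s_s: "s \<otimes> s = \<one>" and t_t: "t \<otimes> t = \<one>"
  using S_involution S_eq by auto

lemma s_s_cancel: "x \<in> carrier W \<Longrightarrow> s \<otimes> (s \<otimes> x) = x"
  and t_t_cancel: "x \<in> carrier W \<Longrightarrow> t \<otimes> (t \<otimes> x) = x"
  by (simp_all add: m_assoc[symmetric] s_s t_t)

text \<open>
  The closed walk \<open>\<dots>, s t, t, 1, s, t s, s t s, \<dots>\<close> of length \<open>2 m\<close> around the Cayley graph, in
  which \<open>k > 0\<close> indexes the alternating word of length \<open>k\<close> that ends in \<open>s\<close>, and \<open>- k\<close> the one
  that ends in \<open>t\<close>.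
\<close>

definition walk :: "int \<Rightarrow> 'a" where
  "walk k = (if even k then \<one> else s) \<otimes> (t \<otimes> s) [^] (k div 2)"

lemma walk_closed [simp]: "walk k \<in> carrier W"
  by (simp add: walk_def)

lemma walk_0: "walk 0 = \<one>"
  by (simp add: walk_def)

text \<open>Left multiplication by \<open>s\<close> swaps the positions \<open>2 j\<close> and
  \<open>2 j + 1\<close>; by \<open>t\<close> it swaps \<open>2 j - 1\<close> and
  \<open>2 j\<close>. These two matchings are the edges of the cycle.\<close>

lemma s_walk: "s \<otimes> walk k = walk (if even k then k + 1 else k - 1)"
  by (auto simp: walk_def s_s_cancel elim!: oddE)

lemma ts_pow_Suc: "(t \<otimes> s) [^] (i + 1 :: int) = t \<otimes> (s \<otimes> (t \<otimes> s) [^] i)"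
  using int_pow_mult[of "t \<otimes> s" 1 i] by (simp add: m_assoc add.commute int_pow_1)

lemma t_walk: "t \<otimes> walk k = walk (if even k then k - 1 else k + 1)"
proof (cases "even k")
  case True
  then obtain j where j: "k = 2 * j" by (elim evenE)
  have "walk k = t \<otimes> (s \<otimes> (t \<otimes> s) [^] (j - 1))"
    using ts_pow_Suc[of "j - 1"] by (simp add: j walk_def)
  moreover have "(2 * j - 1) div 2 = j - 1" by simp
  ultimately show ?thesis by (simp add: j t_t_cancel walk_def)
next
  case False
  then obtain j where j: "k = 2 * j + 1" by (elim oddE)
  have "t \<otimes> walk k = walk (2 * (j + 1))"
    unfolding walk_def using ts_pow_Suc[of j] by (simp add: j del: distrib_left_numeral)
  then show ?thesis by (simp add: j algebra_simps)
qed

lemma walk_1: "walk 1 = s" and walk_m1: "walk (- 1) = t"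
  using s_walk[of 0] t_walk[of 0] by (simp_all add: walk_0)

lemma walk_Suc: "walk (k + 1) = (if even k then s else t) \<otimes> walk k"
  by (simp add: s_walk t_walk)

lemma walk_pred: "walk (k - 1) = (if even k then t else s) \<otimes> walk k"
  by (simp add: s_walk t_walk)

text \<open>Right multiplication commutes with left multiplication by \<open>s\<close> and
  \<open>t\<close>, so it moves the cycle along its labelled edges and takes position 0 to
  \<open>l\<close>. As the labels alternate, it keeps the direction for even \<open>l\<close> and
  reverses it for odd \<open>l\<close>.\<close>

lemma walk_mult: "walk k \<otimes> walk l = walk (if even l then l + k else l - k)"
proof (induction k rule: int_induct[where k = 0])
  case base
  show ?case by (simp add: walk_0)
next
  case (step1 i)
  then have "walk (i + 1) \<otimes> walk l
      = (if even i then s else t) \<otimes> walk (if even l then l + i else l - i)"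
    by (simp add: walk_Suc m_assoc)
  also have "\<dots> = walk (if even l then l + (i + 1) else l - (i + 1))"
    by (auto simp: s_walk t_walk ac_simps diff_diff_eq)
  finally show ?case .
next
  case (step2 i)
  then have "walk (i - 1) \<otimes> walk l
      = (if even i then t else s) \<otimes> walk (if even l then l + i else l - i)"
    by (simp add: walk_pred m_assoc)
  also have "\<dots> = walk (if even l then l + (i - 1) else l - (i - 1))"
    by (auto simp: s_walk t_walk algebra_simps)
  finally show ?case .
qed

lemma inv_walk: "inv (walk k) = walk (if even k then - k else k)"
  by (rule inv_equality) (auto simp: walk_mult walk_0)

lemma range_walk: "range walk = carrier W"
proof
  show "range walk \<subseteq> carrier W" by auto
  have "x \<in> range walk" if "x \<in> generate W S" for x
    using that
  proof induction
    case one
    show ?case using walk_0 by (metis rangeI)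
  next
    case (incl h)
    then show ?case using walk_1 walk_m1 S_eq by (metis insertE rangeI singletonD)
  next
    case (inv h)
    then have "h \<in> range walk" using walk_1 walk_m1 S_eq by (metis insertE rangeI singletonD)
    then show ?case using inv_walk by auto
  next
    case (eng h1 h2)
    then show ?case using walk_mult by auto
  qed
  then show "carrier W \<subseteq> range walk" using S_generates by auto
qed

section \<open>Lengths\<close>

text \<open>Each letter is one step along the cycle, so a word cannot lead farther from 0 than its
  length.\<close>

lemma word_prod_eq_walk:
  assumes "ws \<in> lists S"
  obtains k where "word_prod W ws = walk k" "\<bar>k\<bar> \<le> int (length ws)"
proof -
  have "\<exists>k. word_prod W ws = walk k \<and> \<bar>k\<bar> \<le> int (length ws)"
    using assms
  proof (induction ws rule: list.induct)
    case Nil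
    show ?case using walk_0 by (auto simp: word_prod_def intro!: exI[of _ 0])
  next
    case (Cons x ws)
    then obtain k where k: "word_prod W ws = walk k" "\<bar>k\<bar> \<le> int (length ws)" by auto
    have "x \<in> S" using Cons.prems by simp
    then have x: "x = s \<or> x = t" unfolding S_eq by simp
    have "word_prod W (x # ws) = x \<otimes> walk k" using k(1) by (simp add: word_prod_def)
    moreover from x have "x \<otimes> walk k \<in> {walk (k + 1), walk (k - 1)}"
      by (auto simp: s_walk t_walk)
    ultimately have "word_prod W (x # ws) = walk (k + 1) \<or> word_prod W (x # ws) = walk (k - 1)"
      by auto
    moreover have "\<bar>k + 1\<bar> \<le> int (length (x # ws))" "\<bar>k - 1\<bar> \<le> int (length (x # ws))"
      using k(2) by auto
    ultimately show ?case by blast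
  qed
  then show thesis using that by blast
qed

lemma walk_eq_word_prod:
  obtains ws where "ws \<in> lists S" "int (length ws) = \<bar>k\<bar>" "word_prod W ws = walk k"
proof -
  have "\<exists>ws\<in>lists S. int (length ws) = \<bar>k\<bar> \<and> word_prod W ws = walk k"
  proof (induction k rule: int_induct[where k = 0])
    case base
    show ?case by (intro bexI[of _ "[]"]) (auto simp: word_prod_def walk_0)
  next
    case (step1 i)
    then obtain ws where "ws \<in> lists S" "int (length ws) = \<bar>i\<bar>" "word_prod W ws = walk i" by blast
    with step1(1) show ?case
      by (intro bexI[of _ "(if even i then s else t) # ws"])
        (auto simp: word_prod_def walk_Suc S_eq)
  next
    case (step2 i)
    then obtain ws where "ws \<in> lists S" "int (length ws) = \<bar>i\<bar>" "word_prod W ws = walk i" by blast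
    with step2(1) show ?case
      by (intro bexI[of _ "(if even i then t else s) # ws"])
        (auto simp: word_prod_def walk_pred S_eq)
  qed
  then show thesis using that by blast
qed

lemma walk_eq_one_iff: "walk k = \<one> \<longleftrightarrow> 2 * int m dvd k"
proof -
  \<comment> \<open>The presentation provides the sign character, which excludes that \<open>s\<close> is a power of \<open>t s\<close>.\<close>
  have "even k" if "walk k = \<one>"
  proof -
    obtain ws where ws: "ws \<in> lists S" "int (length ws) = \<bar>k\<bar>" "word_prod W ws = walk k"
      by (rule walk_eq_word_prod)
    then have "even (length ws)"
      using coxeter_equiv_even_length[OF presentation[of ws]] that by simp
    then show "even k" using ws(2) by (metis even_abs_add_iff even_of_nat add_0 dvd_abs_iff)
  qed
  moreover have "walk (2 * j) = \<one> \<longleftrightarrow> int m dvd j" for j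
    using int_pow_eq_id[of "t \<otimes> s" j] ord_ts by (simp add: walk_def)
  ultimately show ?thesis
    by (metis dvd_trans dvd_triv_left evenE dvd_mult_cancel_left zero_neq_numeral)
qed

lemma walk_eq_iff: "walk k = walk l \<longleftrightarrow> 2 * int m dvd k - l"
proof -
  have "walk k = walk l \<longleftrightarrow> walk k \<otimes> inv (walk l) = \<one>"
    by (metis inv_closed inv_equality inv_inv r_inv walk_closed)
  also have "\<dots> \<longleftrightarrow> 2 * int m dvd (if even l then k - l else l - k)"
  proof (cases "even l")
    case True
    then show ?thesis by (simp add: inv_walk walk_mult walk_eq_one_iff dvd_diff_commute)
  next
    case False
    then show ?thesis by (simp add: inv_walk walk_mult walk_eq_one_iff)
  qed
  finally show ?thesis by (simp add: dvd_diff_commute)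
qed

lemma walk_representative:
  assumes "w \<in> carrier W"
  obtains k where "w = walk k" "\<bar>k\<bar> \<le> int m"
proof -
  obtain j where j: "w = walk j" using assms range_walk by auto
  define i where "i = j mod (2 * int m)"
  have i: "0 \<le> i" "i < 2 * int m" using m_ge_2 by (simp_all add: i_def)
  have d: "2 * int m dvd j - i" by (simp add: i_def minus_mod_eq_mult_div)
  show thesis
  proof (cases "i \<le> int m")
    case True
    then show thesis using that[of i] i d by (simp add: j walk_eq_iff)
  next
    case False
    have "2 * int m dvd j - (i - 2 * int m)"
      using dvd_add[OF d dvd_refl] by (simp add: algebra_simps)
    then show thesis using that[of "i - 2 * int m"] i False by (simp add: j walk_eq_iff)
  qed
qed

text \<open>Many positions denote the same element, and its length is the least distance of any of
  them from 0. This form also serves positions outside the range from \<open>- m\<close> to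
  \<open>m\<close>.\<close>

lemma cox_length_walk_le_iff:
  "int (cox_length W S (walk k)) \<le> n \<longleftrightarrow> (\<exists>j. \<bar>j\<bar> \<le> n \<and> walk j = walk k)"
proof
  let ?P = "\<lambda>n. \<exists>ws\<in>lists S. length ws = n \<and> word_prod W ws = walk k"
  obtain vs where "vs \<in> lists S" "word_prod W vs = walk k"
    using walk_eq_word_prod[of k] by blast
  then have "?P (length vs)" by blast
  then have "?P (cox_length W S (walk k))"
    unfolding cox_length_def by (rule LeastI)
  then obtain ws where ws: "ws \<in> lists S" "length ws = cox_length W S (walk k)"
    "word_prod W ws = walk k" by blast
  obtain j where "word_prod W ws = walk j" "\<bar>j\<bar> \<le> int (length ws)"
    using word_prod_eq_walk[OF ws(1)] .
  moreover assume "int (cox_length W S (walk k)) \<le> n"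
  ultimately have "\<bar>j\<bar> \<le> n" "walk j = walk k" using ws by auto
  then show "\<exists>j. \<bar>j\<bar> \<le> n \<and> walk j = walk k" by blast
next
  assume "\<exists>j. \<bar>j\<bar> \<le> n \<and> walk j = walk k"
  then obtain j where j: "\<bar>j\<bar> \<le> n" "walk j = walk k" by blast
  obtain ws where ws: "ws \<in> lists S" "int (length ws) = \<bar>j\<bar>" "word_prod W ws = walk j"
    by (rule walk_eq_word_prod)
  have "cox_length W S (walk k) \<le> length ws"
    unfolding cox_length_def by (rule Least_le) (use ws j in auto)
  then show "int (cox_length W S (walk k)) \<le> n" using ws j by linarith
qed

text \<open>Any other position of the same element differs by a nonzero multiple of
  \<open>2 m\<close>, so it cannot be closer to 0.\<close>

lemma cox_length_walk:
  assumes "\<bar>k\<bar> \<le> int m"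
  shows "int (cox_length W S (walk k)) = \<bar>k\<bar>"
proof (rule antisym)
  show "int (cox_length W S (walk k)) \<le> \<bar>k\<bar>" using cox_length_walk_le_iff by blast
  obtain j where j: "\<bar>j\<bar> \<le> int (cox_length W S (walk k))" "walk j = walk k"
    using cox_length_walk_le_iff by blast
  have "\<bar>k\<bar> \<le> \<bar>j\<bar>"
  proof (rule ccontr)
    assume "\<not> \<bar>k\<bar> \<le> \<bar>j\<bar>"
    then have "j - k \<noteq> 0" "\<bar>j - k\<bar> < 2 * int m" using assms by auto
    moreover have "2 * int m dvd j - k" using j(2) by (simp add: walk_eq_iff)
    ultimately show False using dvd_imp_le_int[of "j - k" "2 * int m"] by simp
  qed
  then show "\<bar>k\<bar> \<le> int (cox_length W S (walk k))" using j(1) by simp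
qed

section \<open>Reflections and inversions\<close>

lemma reflections_eq: "reflections W S = walk ` {l. odd l}"
proof
  show "reflections W S \<subseteq> walk ` {l. odd l}"
  proof
    fix r assume "r \<in> reflections W S"
    then obtain w x where wx: "w \<in> carrier W" "x \<in> S" "r = w \<otimes> x \<otimes> inv w"
      by (auto simp: reflections_def)
    obtain k where "w = walk k" using wx(1) range_walk by blast
    moreover obtain l where "x = walk l" "odd l"
      using wx(2) walk_1 walk_m1 S_eq by (metis insertE odd_one even_minus singletonD)
    ultimately have "r = walk (if even k then l - 2 * k else 2 * k - l)"
      using wx(3) by (simp add: inv_walk walk_mult)
    then show "r \<in> walk ` {l. odd l}" using \<open>odd l\<close> by auto
  qed
  have "walk l \<in> reflections W S" if "odd l" for l
  proof -
    obtain j where j: "l = 2 * j + 1" using \<open>odd l\<close> by (elim oddE)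
    \<comment> \<open>Conjugation by the element at an even position \<open>k\<close> takes the odd
      position \<open>l\<close> to \<open>l - 2 k\<close>. So \<open>s\<close> at 1 and
      \<open>t\<close> at -1 are moved to \<open>2 j + 1\<close> by whichever of \<open>- j\<close>
      and \<open>- j - 1\<close> is even.\<close>
    show ?thesis
    proof (cases "even j")
      case True
      have "walk l = walk (- j) \<otimes> walk 1 \<otimes> inv (walk (- j))"
        using True by (simp add: inv_walk walk_mult j)
      then have "walk l = walk (- j) \<otimes> s \<otimes> inv (walk (- j))" by (simp only: walk_1)
      then show ?thesis unfolding reflections_def S_eq by auto
    next
      case False
      then have "walk l = walk (- j - 1) \<otimes> walk (- 1) \<otimes> inv (walk (- j - 1))"
        by (simp add: inv_walk walk_mult j)
      then have "walk l = walk (- j - 1) \<otimes> t \<otimes> inv (walk (- j - 1))" by (simp only: walk_m1)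
      then show ?thesis unfolding reflections_def S_eq by auto
    qed
  qed
  then show "walk ` {l. odd l} \<subseteq> reflections W S" by auto
qed

text \<open>The product of the elements at \<open>k\<close> and at an odd \<open>l\<close> lies at
  \<open>l - k\<close>. If it is shorter, then \<open>l - k\<close> is congruent modulo
  \<open>2 m\<close> to some \<open>j\<close> closer to 0 than \<open>k\<close>, and the reflection
  can be relocated to \<open>j + k\<close>.\<close>

lemma inversions_walk:
  assumes "\<bar>k\<bar> \<le> int m"
  shows "inversions W S (walk k) = walk ` {l. odd l \<and> \<bar>l - k\<bar> < \<bar>k\<bar>}"
proof
  have less_iff: "cox_length W S (walk k \<otimes> walk l) < cox_length W S (walk k) \<longleftrightarrow>
      (\<exists>j. \<bar>j\<bar> < \<bar>k\<bar> \<and> walk j = walk (l - k))" if "odd l" for l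
  proof -
    \<comment> \<open>For \<open>k = 0\<close> the bound is -1, and both sides are false.\<close>
    have "cox_length W S (walk k \<otimes> walk l) < cox_length W S (walk k) \<longleftrightarrow>
        int (cox_length W S (walk (l - k))) \<le> \<bar>k\<bar> - 1"
      using that cox_length_walk[OF assms] by (simp add: walk_mult) linarith
    then show ?thesis unfolding cox_length_walk_le_iff by simp
  qed
  show "inversions W S (walk k) \<subseteq> walk ` {l. odd l \<and> \<bar>l - k\<bar> < \<bar>k\<bar>}"
  proof
    fix r assume "r \<in> inversions W S (walk k)"
    then obtain l where l: "r = walk l" "odd l"
      "cox_length W S (walk k \<otimes> walk l) < cox_length W S (walk k)"
      by (auto simp: inversions_def reflections_eq)
    then obtain j where j: "\<bar>j\<bar> < \<bar>k\<bar>" "walk j = walk (l - k)" using less_iff by blast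
    have d: "2 * int m dvd (j + k) - l" using j(2) by (simp add: walk_eq_iff algebra_simps)
    then have "even (j + k - l)" by (meson dvd_trans dvd_triv_left)
    then have "odd (j + k)" using l(2) by simp
    moreover have "r = walk (j + k)" using d l(1) by (metis walk_eq_iff)
    ultimately show "r \<in> walk ` {l. odd l \<and> \<bar>l - k\<bar> < \<bar>k\<bar>}" using j(1) by auto
  qed
  show "walk ` {l. odd l \<and> \<bar>l - k\<bar> < \<bar>k\<bar>} \<subseteq> inversions W S (walk k)"
    using less_iff by (auto simp: inversions_def reflections_eq)
qed

section \<open>The upper bound and its attainment\<close>

text \<open>By minimality it suffices to find a complete subset of at most two elements; the
  positions farthest from 0 on each side provide it.\<close>

lemma minimal_inversion_complete_card_le:
  assumes "minimal_inversion_complete W S Y"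
  shows "card Y \<le> 2"
proof -
  have Y: "Y \<subseteq> carrier W" "(\<Union>w\<in>Y. inversions W S w) = reflections W S"
    and min: "\<And>Z. Z \<subset> Y \<Longrightarrow> \<not> inversion_complete W S Z"
    using assms by (auto simp: minimal_inversion_complete_def inversion_complete_def)
  let ?N = "\<lambda>k. inversions W S (walk k)"
  \<comment> \<open>Position 0 may lie in both sets, and \<open>m\<close> and \<open>- m\<close>
    denote the same element. The overlap is harmless, since only a cover of \<open>Y\<close> is
    wanted.\<close>
  define P where "P = {k \<in> {0..int m}. walk k \<in> Y}"
  define Q where "Q = {k \<in> {- int m..0}. walk k \<in> Y}"
  have "\<exists>J\<subseteq>P. finite J \<and> card J \<le> 1 \<and> (\<Union>k\<in>P. ?N k) \<subseteq> (\<Union>k\<in>J. ?N k)"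
  proof (rule UN_abs_chain)
    show "finite P" unfolding P_def by (rule finite_subset[of _ "{0..int m}"]) auto
  qed (auto simp: P_def inversions_walk)
  then obtain J where J: "J \<subseteq> P" "finite J" "card J \<le> 1" "(\<Union>k\<in>P. ?N k) \<subseteq> (\<Union>k\<in>J. ?N k)"
    by blast
  have "\<exists>K\<subseteq>Q. finite K \<and> card K \<le> 1 \<and> (\<Union>k\<in>Q. ?N k) \<subseteq> (\<Union>k\<in>K. ?N k)"
  proof (rule UN_abs_chain)
    show "finite Q" unfolding Q_def by (rule finite_subset[of _ "{- int m..0}"]) auto
  qed (auto simp: Q_def inversions_walk)
  then obtain K where K: "K \<subseteq> Q" "finite K" "card K \<le> 1" "(\<Union>k\<in>Q. ?N k) \<subseteq> (\<Union>k\<in>K. ?N k)"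
    by blast
  define Z where "Z = walk ` (J \<union> K)"
  have Z: "Z \<subseteq> Y" using J(1) K(1) by (auto simp: Z_def P_def Q_def)
  have "inversions W S w \<subseteq> (\<Union>z\<in>Z. inversions W S z)" if w: "w \<in> Y" for w
  proof -
    obtain k where k: "w = walk k" "\<bar>k\<bar> \<le> int m"
      using walk_representative w Y(1) by blast
    then have "k \<in> P \<or> k \<in> Q" using w by (auto simp: P_def Q_def)
    then have "inversions W S w \<subseteq> (\<Union>k\<in>P. ?N k) \<union> (\<Union>k\<in>Q. ?N k)" using k(1) by auto
    also have "\<dots> \<subseteq> (\<Union>k\<in>J \<union> K. ?N k)" using J(4) K(4) by auto
    finally show ?thesis by (simp add: Z_def)
  qed
  then have "(\<Union>z\<in>Z. inversions W S z) = (\<Union>w\<in>Y. inversions W S w)"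
    using Z by blast
  then have "inversion_complete W S Z"
    using Z Y by (auto simp: inversion_complete_def)
  then have "Z = Y" using min Z by blast
  moreover have "card Z \<le> card (J \<union> K)" unfolding Z_def using J(2) K(2) by (simp add: card_image_le)
  moreover have "card (J \<union> K) \<le> 2" using card_Un_le[of J K] J(3) K(3) by simp
  ultimately show ?thesis by simp
qed

lemma ex_minimal_inversion_complete_card_2:
  "\<exists>Y. minimal_inversion_complete W S Y \<and> card Y = 2"
proof -
  \<comment> \<open>These have length \<open>m - 1\<close>. The longest element, at
    \<open>m\<close>, would be complete by itself, whereas \<open>a\<close> misses exactly
    \<open>t\<close> and \<open>b\<close> misses exactly \<open>s\<close>.\<close>
  define a where "a = walk (int m - 1)"
  define b where "b = walk (1 - int m)"
  have Na: "inversions W S a = walk ` {l. odd l \<and> 0 < l \<and> l < 2 * int m - 2}"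
    using m_ge_2 unfolding a_def by (subst inversions_walk) (auto intro!: image_cong)
  have Nb: "inversions W S b = walk ` {l. odd l \<and> 2 - 2 * int m < l \<and> l < 0}"
    using m_ge_2 unfolding b_def by (subst inversions_walk) (auto intro!: image_cong)
  have sub: "inversions W S w \<subseteq> reflections W S" for w
    by (auto simp: inversions_def)
  have small: "d = 0" if "2 * int m dvd d" "\<bar>d\<bar> < 2 * int m" for d
    using that dvd_imp_le_int[of d "2 * int m"] by (cases "d = 0") auto
  have sa: "s \<in> inversions W S a"
    unfolding Na by (rule image_eqI[where x = 1]) (use m_ge_2 in \<open>simp_all add: walk_1\<close>)
  have s: "s \<in> reflections W S"
    unfolding reflections_eq by (rule image_eqI[where x = 1]) (simp_all add: walk_1)
  have t: "t \<in> reflections W S"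
    unfolding reflections_eq by (rule image_eqI[where x = "- 1"]) (simp_all add: walk_m1)
  have sb: "s \<notin> inversions W S b"
  proof
    assume "s \<in> inversions W S b"
    then obtain l where l: "walk 1 = walk l" "2 - 2 * int m < l" "l < 0"
      by (auto simp: Nb walk_1)
    then show False using small[of "1 - l"] by (auto simp: walk_eq_iff)
  qed
  have ta: "t \<notin> inversions W S a"
  proof
    assume "t \<in> inversions W S a"
    then obtain l where l: "walk (- 1) = walk l" "0 < l" "l < 2 * int m - 2"
      by (auto simp: Na walk_m1)
    then show False using small[of "- 1 - l"] by (auto simp: walk_eq_iff)
  qed
  have "r \<in> inversions W S a \<union> inversions W S b" if r: "r \<in> reflections W S" for r
  proof -
    obtain j where j: "r = walk j" "odd j" using r by (auto simp: reflections_eq)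
    define l where "l = j mod (2 * int m)"
    have bounds: "0 \<le> l" "l < 2 * int m" using m_ge_2 by (simp_all add: l_def)
    have d: "2 * int m dvd j - l" by (simp add: l_def minus_mod_eq_mult_div)
    then have "even (j - l)" by (meson dvd_trans dvd_triv_left)
    then have "odd l" using j(2) by simp
    have r_eq: "r = walk l" using d j(1) by (simp add: walk_eq_iff)
    show ?thesis
    proof (cases "l < 2 * int m - 2")
      case True
      moreover have "0 < l" using bounds \<open>odd l\<close> by (cases "l = 0") auto
      ultimately show ?thesis using r_eq \<open>odd l\<close> by (auto simp: Na)
    next
      case False
      \<comment> \<open>The one odd position of the period left over by \<open>a\<close> is that of
        \<open>t\<close>, which is also at -1 and so among the inversions of
        \<open>b\<close>.\<close>
      then have "l = 2 * int m - 1" using bounds \<open>odd l\<close> by presburger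
      then have "r = walk (- 1)" by (simp add: r_eq walk_eq_iff)
      then show ?thesis using m_ge_2 by (auto simp: Nb)
    qed
  qed
  then have "inversions W S a \<union> inversions W S b = reflections W S" using sub by blast
  then have "inversion_complete W S {a, b}"
    by (simp add: inversion_complete_def a_def b_def)
  moreover have "\<not> inversion_complete W S Z" if "Z \<subset> {a, b}" for Z
  proof -
    have "Z \<subseteq> {a} \<or> Z \<subseteq> {b}" using that by blast
    then show ?thesis using s t sb ta unfolding inversion_complete_def by blast
  qed
  moreover have "a \<noteq> b" using sa sb by blast
  ultimately show ?thesis
    by (intro exI[of _ "{a, b}"]) (simp add: minimal_inversion_complete_def)
qed

lemma MC_eq_2: "MC W S = 2"
  unfolding MC_def
proof (rule Max_eqI)
  show "finite {card Y |Y. minimal_inversion_complete W S Y}"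
    \<comment> \<open>\<open>Max\<close> requires a finite set of cardinalities; the upper bound
      supplies this too.\<close>
    by (rule finite_subset[of _ "{..2}"]) (auto simp: minimal_inversion_complete_card_le)
  show "2 \<in> {card Y |Y. minimal_inversion_complete W S Y}"
    using ex_minimal_inversion_complete_card_2 by (metis (mono_tags) mem_Collect_eq)
qed (auto simp: minimal_inversion_complete_card_le)

end

theorem mainTheorem6:
  fixes W :: "('a, 'b) monoid_scheme" and S :: "'a set" and m :: nat
  assumes "m \<ge> 2" and "coxeter_system_I2 m W S"
  shows "MC W S = 2"
proof -
  \<comment> \<open>The names are exchanged, \<open>t\<close> for \<open>s1\<close> and
    \<open>s\<close> for \<open>s2\<close>, so that the product of known order is the rotation
    \<open>t s\<close> that defines \<open>walk\<close>.\<close>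
  obtain s t where st: "coxeter_system W S" "S = {s, t}" "group.ord W (t \<otimes>\<^bsub>W\<^esub> s) = m"
    using assms(2) unfolding coxeter_system_I2_def by (metis insert_commute)
  interpret coxeter_system W S by (rule st(1))
  interpret dihedral_coxeter_system W S s t m
    by unfold_locales (use st assms(1) in auto)
  show ?thesis by (rule MC_eq_2)
qed

end
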